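(* Write $f(k,m,n)=f_{\text{2--1--2'}}(k,m,n)$. Then: (i) $f(2,m,n)=2^{n-m-1}$ for $1\le m\le n-4$; (ii) $f(2,n-2,n)=7$ for $n\ge4$; (iii) $f(2,n-1,n)=1$ for $n\ge4$; (iv) $f(2,m,n)=0$ for all other pairs $(m,n)$.
   Context: The standard cycle form of $\pi\in\mathcal S_n$ writes each cycle starting with its smallest element, cycles listed in decreasing order of smallest elements; $\Psi(\pi)$ is the word obtained by deleting the parentheses. A cyclic occurrence of 2--1--2' in $\pi$ is a triple of indices $i<j<k$ with $w_j<w_i$ and $w_j<w_k$, where $w=\Psi(\pi)$. $f_{\text{2--1--2'}}(k,m,n)$ is the number of $\pi\in\mathcal S_n$ with $m$ cycles and exactly $k$ cyclic occurrences of 2--1--2'. *)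

theory Defs
  imports Main "HOL-Combinatorics.Orbits" "HOL-Combinatorics.Cycles"
begin

text \<open>A permutation in \<open>S\<^sub>n\<close> is a function \<open>p\<close> with \<open>p permutes {1..n}\<close>.
  Its fixed points in \<open>{1..n}\<close> count as cycles of length one.\<close>

definition perm_cycles :: "nat \<Rightarrow> (nat \<Rightarrow> nat) \<Rightarrow> nat set set" where
  "perm_cycles n p = orbit p ` {1..n}"

text \<open>The library's \<open>support p a\<close> is the list \<open>[a, p a, p (p a), \<dots>]\<close> running once through the
  cycle of \<open>a\<close>.\<close>

definition standard_cycle_form :: "nat \<Rightarrow> (nat \<Rightarrow> nat) \<Rightarrow> nat list list" where
  "standard_cycle_form n p =
     map (support p) (rev (sorted_list_of_set (Min ` perm_cycles n p)))"

definition Psi :: "nat \<Rightarrow> (nat \<Rightarrow> nat) \<Rightarrow> nat list" where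
  "Psi n p = concat (standard_cycle_form n p)"

text \<open>Positions in words are counted from 0.\<close>

definition cyc_occurrences_212' :: "nat \<Rightarrow> (nat \<Rightarrow> nat) \<Rightarrow> (nat \<times> nat \<times> nat) set" where
  "cyc_occurrences_212' n p =
     {(i, j, k). i < j \<and> j < k \<and> k < length (Psi n p) \<and>
        Psi n p ! j < Psi n p ! i \<and> Psi n p ! j < Psi n p ! k}"

definition f_212' :: "nat \<Rightarrow> nat \<Rightarrow> nat \<Rightarrow> nat" where
  "f_212' k m n =
     card {p. p permutes {1..n} \<and> card (perm_cycles n p) = m \<and>
              card (cyc_occurrences_212' n p) = k}"

end

theory Submission
  imports Defs "HOL-Combinatorics.Multiset_Permutations"
begin

text \<open>
  The blocks of \<open>\<Psi>(\<pi>)\<close> beginning at its left-to-right minima are the cycles of \<open>\<pi>\<close>, so the problem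
  is to count words on \<open>{1..n}\<close> with \<open>m\<close> left-to-right minima and two occurrences of 2--1--2'.
  Inserting a new smallest letter with \<open>a\<close> letters before it and \<open>b\<close> after it creates exactly
  \<open>a * b\<close> occurrences and destroys none. If \<open>a + b \<ge> 4\<close> and \<open>a, b \<ge> 1\<close> then \<open>a * b \<ge> 3\<close>; hence
  for \<open>n \<ge> 4\<close> the words of length \<open>n + 1\<close> arise by putting the new minimum first (leaving one
  left-to-right minimum) or last (adding one). The resulting recurrence starts from the eight words
  of length 4.
\<close>

section \<open>Permutations and words\<close>

function blocks :: "'a::linorder list \<Rightarrow> 'a list list" where
  "blocks [] = []"
| "blocks (x # w) = (x # takeWhile (\<lambda>y. x < y) w) # blocks (dropWhile (\<lambda>y. x < y) w)"
  by pat_completeness auto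
termination
  by (relation "measure length") (auto simp: le_imp_less_Suc length_dropWhile_le)

text \<open>Inside a list every letter exceeds the head, so \<open>takeWhile\<close> runs through to
  its end; the next head is smaller and stops it there. This is why erasing the parentheses of a
  standard cycle form loses nothing.\<close>

lemma blocks_concat:
  assumes "\<And>c. c \<in> set cs \<Longrightarrow> c \<noteq> [] \<and> (\<forall>x\<in>set (tl c). hd c < x)"
    and "sorted_wrt (>) (map hd cs)"
  shows "blocks (concat cs) = cs"
  using assms
proof (induction cs)
  case (Cons c cs)
  obtain x xs where c: "c = x # xs" and xs: "\<forall>y\<in>set xs. x < y"
    using Cons.prems(1)[of c] by (cases c) auto
  have IH: "blocks (concat cs) = cs"
    using Cons by auto
  show ?case
  proof (cases cs)
    case Nil
    then show ?thesis using xs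
      by (simp add: c takeWhile_eq_all_conv[THEN iffD2] dropWhile_eq_Nil_conv[THEN iffD2])
  next
    case (Cons d ds)
    then obtain y ys where d: "d = y # ys"
      using Cons.prems(1)[of d] by (cases d) auto
    have "\<not> x < y"
      using Cons.prems(2) by (auto simp: Cons c d)
    then have "takeWhile (\<lambda>y. x < y) (xs @ concat cs) = xs"
      and "dropWhile (\<lambda>y. x < y) (xs @ concat cs) = concat cs"
      using xs by (auto simp: takeWhile_append2 dropWhile_append2 Cons d)
    then show ?thesis using IH by (simp add: c)
  qed
qed simp

lemma support_Cons:
  assumes "permutation p"
  shows "support p a = a # tl (support p a)"
proof -
  have "0 < least_power p a"
    using least_power_of_permutation(2)[OF assms] .
  then show ?thesis
    by (simp add: upt_conv_Cons)
qed

lemma set_support_orbit: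
  assumes "permutation p"
  shows "set (support p a) = orbit p a"
  unfolding support_set[OF assms] orbit_altdef_permutation[OF assms] by auto

section \<open>Cycles, their minima, and the word of a permutation\<close>

context
  fixes n :: nat and p :: "nat \<Rightarrow> nat"
  assumes p: "p permutes {1..n}"
begin

lemma permutation_p: "permutation p"
  using p permutation_permutes by blast

lemma finite_orbit_perm: "finite (orbit p x)"
  using finite_orbit permutation_self_in_orbit[OF permutation_p] by metis

lemma Min_orbit_in: "Min (orbit p x) \<in> orbit p x"
  using finite_orbit_perm orbit_nonempty by (rule Min_in)

text \<open>Any element of a cycle generates it, so the minimum can serve as its canonical
  name.\<close>

lemma orbit_Min_orbit: "orbit p (Min (orbit p x)) = orbit p x"
  using orbit_cyclic_eq3[OF cyclic_on_orbit'[OF permutation_p] Min_orbit_in] .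

lemma cycle_minD:
  assumes "a \<in> Min ` perm_cycles n p"
  shows "a \<in> {1..n}" "Min (orbit p a) = a"
proof -
  obtain x where x: "x \<in> {1..n}" "a = Min (orbit p x)"
    using assms by (auto simp: perm_cycles_def)
  then show "a \<in> {1..n}"
    using Min_orbit_in permutes_orbit_subset[OF p] by blast
  show "Min (orbit p a) = a"
    using orbit_Min_orbit x by simp
qed

lemma finite_cycle_mins: "finite (Min ` perm_cycles n p)"
  by (simp add: perm_cycles_def)

lemma inj_on_Min_perm_cycles: "inj_on Min (perm_cycles n p)"
  unfolding perm_cycles_def by (auto intro!: inj_onI) (metis orbit_Min_orbit)+

lemma map_hd_standard_cycle_form:
  "map hd (standard_cycle_form n p) = rev (sorted_list_of_set (Min ` perm_cycles n p))"
proof -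
  have "hd (support p a) = a" for a
    by (subst support_Cons[OF permutation_p]) simp
  then show ?thesis
    unfolding standard_cycle_form_def map_map by (intro map_idI) (simp only: comp_apply)
qed

text \<open>The two conventions of the standard form, least element first and decreasing minima, are
  exactly the hypotheses of \<open>blocks_concat\<close>.\<close>

lemma blocks_Psi: "blocks (Psi n p) = standard_cycle_form n p"
  unfolding Psi_def
proof (rule blocks_concat)
  fix c assume "c \<in> set (standard_cycle_form n p)"
  then obtain a where a: "a \<in> Min ` perm_cycles n p" "c = support p a"
    using finite_cycle_mins by (auto simp: standard_cycle_form_def)
  have c: "c = a # tl c"
    unfolding a by (rule support_Cons[OF permutation_p])
  have "distinct c"
    unfolding a by (rule cycle_of_permutation[OF permutation_p])
  then have "a \<notin> set (tl c)"
    by (subst (asm) c) simp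
  moreover have "a \<le> x" if "x \<in> set (tl c)" for x
  proof -
    have "x \<in> orbit p a"
      using that set_support_orbit[OF permutation_p, of a] c a(2) by (metis list.set_intros(2))
    then show ?thesis
      using cycle_minD(2)[OF a(1)] finite_orbit_perm Min_le by metis
  qed
  ultimately have "\<forall>x\<in>set (tl c). a < x"
    by (metis order_le_less)
  then show "c \<noteq> [] \<and> (\<forall>x\<in>set (tl c). hd c < x)"
    using c by (metis list.sel(1) list.distinct(1))
next
  show "sorted_wrt (>) (map hd (standard_cycle_form n p))"
    unfolding map_hd_standard_cycle_form by (simp add: sorted_wrt_rev)
qed

lemma length_blocks_Psi: "length (blocks (Psi n p)) = card (perm_cycles n p)"
  unfolding blocks_Psi
  by (simp add: standard_cycle_form_def card_image inj_on_Min_perm_cycles)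

lemma Psi_in_words: "Psi n p \<in> permutations_of_set {1..n}"
proof (rule permutations_of_setI)
  let ?M = "Min ` perm_cycles n p"
  have "set (concat (map f xs)) = (\<Union>a\<in>set xs. set (f a))" for f :: "nat \<Rightarrow> nat list" and xs
    by auto
  from this[of "support p"] have "set (Psi n p) = (\<Union>a\<in>?M. orbit p a)"
    unfolding Psi_def standard_cycle_form_def set_support_orbit[OF permutation_p]
    using finite_cycle_mins by (simp only: set_rev set_sorted_list_of_set)
  also have "\<dots> = (\<Union>x\<in>{1..n}. orbit p x)"
    by (simp add: perm_cycles_def image_image orbit_Min_orbit)
  also have "\<dots> = {1..n}"
    using permutes_orbit_subset[OF p] permutation_self_in_orbit[OF permutation_p] by blast
  finally show "set (Psi n p) = {1..n}" .
next
  \<comment> \<open>A cycle listed twice would repeat its head.\<close>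
  have "distinct (map hd (standard_cycle_form n p))"
    unfolding map_hd_standard_cycle_form by simp
  then have d: "distinct (standard_cycle_form n p)"
    by (simp only: distinct_map)
  show "distinct (Psi n p)"
    unfolding Psi_def
  proof (rule distinct_concat[OF d])
    fix c assume "c \<in> set (standard_cycle_form n p)"
    then show "distinct c"
      using cycle_of_permutation[OF permutation_p] by (auto simp only: standard_cycle_form_def set_map)
  next
    fix c d assume *: "c \<in> set (standard_cycle_form n p)" "d \<in> set (standard_cycle_form n p)" "c \<noteq> d"
    then obtain a b where ab: "a \<in> Min ` perm_cycles n p" "b \<in> Min ` perm_cycles n p"
      "c = support p a" "d = support p b"
      using finite_cycle_mins
      by (auto simp only: standard_cycle_form_def set_map set_rev set_sorted_list_of_set)
    then have "a \<noteq> b" using * by metis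
    \<comment> \<open>Cycles sharing a letter have equal orbits, hence equal minima, against
      \<open>a \<noteq> b\<close>.\<close>
    show "set c \<inter> set d = {}"
    proof (rule ccontr)
      assume "set c \<inter> set d \<noteq> {}"
      then obtain x where "x \<in> orbit p a" "x \<in> orbit p b"
        using ab set_support_orbit[OF permutation_p] by auto
      then have "orbit p a = orbit p b"
        using orbit_cyclic_eq3[OF cyclic_on_orbit'[OF permutation_p]] by metis
      then show False
        using cycle_minD(2) ab \<open>a \<noteq> b\<close> by metis
    qed
  qed
qed

end

text \<open>By \<open>blocks_Psi\<close> the word determines the cycle form. Its heads give the
  cycle minima, and the cycle lists give the values of the permutation.\<close>

lemma inj_on_Psi: "inj_on (Psi n) {p. p permutes {1..n}}"
proof (rule inj_onI)
  fix p q assume "p \<in> {p. p permutes {1..n}}" "q \<in> {p. p permutes {1..n}}" and eq: "Psi n p = Psi n q"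
  then have p: "p permutes {1..n}" and q: "q permutes {1..n}"
    by auto
  have form: "standard_cycle_form n p = standard_cycle_form n q"
    using eq blocks_Psi[OF p] blocks_Psi[OF q] by metis
  define mins where "mins = rev (sorted_list_of_set (Min ` perm_cycles n p))"
  have "mins = rev (sorted_list_of_set (Min ` perm_cycles n q))"
    unfolding mins_def using map_hd_standard_cycle_form[OF p] map_hd_standard_cycle_form[OF q] form
    by simp
  then have "map (support p) mins = map (support q) mins"
    using form unfolding standard_cycle_form_def mins_def by simp
  then have "\<forall>a\<in>set mins. support p a = support q a"
    by (simp only: map_eq_conv)
  moreover have "set mins = Min ` perm_cycles n p"
    unfolding mins_def using finite_cycle_mins[OF p] by simp
  ultimately have M: "support p a = support q a" if "a \<in> Min ` perm_cycles n p" for a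
    using that by blast
  show "p = q"
  proof
    fix x
    show "p x = q x"
    proof (cases "x \<in> {1..n}")
      case True
      let ?a = "Min (orbit p x)"
      have a: "?a \<in> Min ` perm_cycles n p"
        using True by (simp add: perm_cycles_def)
      have x: "x \<in> set (support p ?a)"
        unfolding set_support_orbit[OF permutation_p[OF p]] orbit_Min_orbit[OF p]
        by (rule permutation_self_in_orbit[OF permutation_p[OF p]])
      \<comment> \<open>\<open>cycle_restrict\<close> reads the image of \<open>x\<close> off the
        cycle list containing it, and that list is the same for \<open>p\<close> and
        \<open>q\<close>.\<close>
      then show ?thesis
        using cycle_restrict[OF permutation_p[OF p] x] cycle_restrict[OF permutation_p[OF q], of x ?a] M[OF a] by metis
    next
      case False
      then show ?thesis using p q by (simp add: permutes_not_in)
    qed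
  qed
qed

section \<open>Transfer of the count to words\<close>

lemma Psi_image: "Psi n ` {p. p permutes {1..n}} = permutations_of_set {1..n}"
proof (rule card_subset_eq)
  \<comment> \<open>Both sides have n! elements, so injectivity already gives surjectivity and no
    inverse map has to be built.\<close>
  have "card {p. p permutes {1..n}} = fact n"
    by (rule card_permutations) auto
  then show "card (Psi n ` {p. p permutes {1..n}}) = card (permutations_of_set {1..n})"
    by (simp add: card_image[OF inj_on_Psi] del: One_nat_def)
qed (use Psi_in_words in auto)

text \<open>Depends on the word alone, so letters can be inserted without tracking the effect on a
  permutation.\<close>

definition occ_212' :: "'a::linorder list \<Rightarrow> (nat \<times> nat \<times> nat) set" where
  "occ_212' w = {(i, j, k). i < j \<and> j < k \<and> k < length w \<and> w ! j < w ! i \<and> w ! j < w ! k}"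

definition words_212' :: "nat \<Rightarrow> nat \<Rightarrow> nat list set" where
  "words_212' k n = {w \<in> permutations_of_set {1..n}. card (occ_212' w) = k}"

lemma f_212'_words: "f_212' k m n = card {w \<in> words_212' k n. length (blocks w) = m}"
proof -
  let ?P = "{p. p permutes {1..n} \<and> card (perm_cycles n p) = m \<and> card (cyc_occurrences_212' n p) = k}"
  have "Psi n ` ?P = {w \<in> words_212' k n. length (blocks w) = m}"
    unfolding words_212'_def Psi_image[symmetric]
    by (auto simp: length_blocks_Psi cyc_occurrences_212'_def occ_212'_def)
  moreover have "inj_on (Psi n) ?P"
    by (rule inj_on_subset[OF inj_on_Psi]) auto
  then have "card (Psi n ` ?P) = card ?P"
    by (rule card_image)
  ultimately show ?thesis
    unfolding f_212'_def by simp
qed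

section \<open>Inserting a new minimum\<close>

lemma finite_occ_212': "finite (occ_212' w)"
proof (rule finite_subset)
  show "occ_212' w \<subseteq> {..<length w} \<times> {..<length w} \<times> {..<length w}"
    by (auto simp: occ_212'_def)
qed auto

text \<open>The new minimum can only be the middle letter of an occurrence, and there it works with
  every letter before it and every letter after it. All other triples keep their relative
  order.\<close>

lemma card_occ_212'_insert_min:
  assumes x: "\<And>y. y \<in> set xs \<union> set ys \<Longrightarrow> x < y"
  shows "card (occ_212' (xs @ x # ys)) = card (occ_212' (xs @ ys)) + length xs * length ys"
proof -
  let ?l = "length xs"
  let ?w = "xs @ x # ys" and ?u = "xs @ ys"
  \<comment> \<open>\<open>s\<close> sends positions of the old word to the new one, skipping the
    inserted position; \<open>?N\<close> collects the triples centred there.\<close>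
  define s where "s = (\<lambda>i. if i < ?l then i else Suc i)"
  define S where "S = (\<lambda>(i, j, k). (s i, s j, s k))"
  let ?N = "{..<?l} \<times> {?l} \<times> {?l<..<length ?w}"
  have s_less: "s i < s j \<longleftrightarrow> i < j" for i j
    by (auto simp: s_def)
  have s_len: "s i < length ?w \<longleftrightarrow> i < length ?u" for i
    by (auto simp: s_def)
  have s_nth: "?w ! s i = ?u ! i" for i
    by (auto simp: s_def nth_append Suc_diff_le)
  have s_ex: "\<exists>j. i = s j" if "i \<noteq> ?l" for i
  proof (cases "i < ?l")
    case True
    then have "i = s i" by (simp add: s_def)
    then show ?thesis ..
  next
    case False
    then have "i = s (i - 1)" using that by (auto simp: s_def)
    then show ?thesis ..
  qed
  have nth_gt: "x < ?w ! i" if "i < length ?w" "i \<noteq> ?l" for i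
    using that x by (auto simp: nth_append nth_Cons')
  have mem: "S t \<in> occ_212' ?w \<longleftrightarrow> t \<in> occ_212' ?u" for t
    by (cases t) (simp only: S_def occ_212'_def mem_Collect_eq prod.case s_less s_len s_nth)
  have "occ_212' ?w = S ` occ_212' ?u \<union> ?N"
  proof (intro equalityI subsetI)
    fix t assume t: "t \<in> occ_212' ?w"
    obtain i j k where ijk: "t = (i, j, k)" by (cases t)
    show "t \<in> S ` occ_212' ?u \<union> ?N"
    proof (cases "j = ?l")
      case True
      then show ?thesis using t by (auto simp: ijk occ_212'_def)
    next
      case False
      \<comment> \<open>The outer letters exceed the middle one, which exceeds \<open>x\<close>; so
        none of the three is the new letter.\<close>
      then have "x < ?w ! j"
        using t nth_gt[of j] by (simp add: ijk occ_212'_def)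
      moreover have "?w ! j < ?w ! i" "?w ! j < ?w ! k" "?w ! ?l = x"
        using t by (auto simp: ijk occ_212'_def)
      ultimately have "i \<noteq> ?l" "k \<noteq> ?l"
        by auto
      then obtain i' j' k' where "i = s i'" "j = s j'" "k = s k'"
        using s_ex False by metis
      then have "t = S (i', j', k')"
        by (simp add: ijk S_def)
      then show ?thesis using t mem by blast
    qed
  next
    fix t assume "t \<in> S ` occ_212' ?u \<union> ?N"
    then show "t \<in> occ_212' ?w"
    proof
      assume "t \<in> ?N"
      then obtain i k where "t = (i, ?l, k)" "i < ?l" "?l < k" "k < length ?w"
        by auto
      then show ?thesis
        using nth_gt[of i] nth_gt[of k] by (simp add: occ_212'_def)
    qed (use mem in blast)
  qed
  moreover have "S ` occ_212' ?u \<inter> ?N = {}"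
    by (auto simp: S_def s_def split: if_splits)
  moreover have "inj S"
    by (auto simp: S_def s_def inj_def split: if_splits)
  then have "card (S ` occ_212' ?u) = card (occ_212' ?u)"
    by (meson card_image inj_on_subset subset_UNIV)
  ultimately show ?thesis
    by (simp add: card_Un_disjoint finite_occ_212' card_cartesian_product)
qed

lemma occ_212'_map_Suc: "occ_212' (map Suc w) = occ_212' w"
  by (auto simp: occ_212'_def)

lemma length_blocks_map_Suc: "length (blocks (map Suc w)) = length (blocks w)"
  by (induction w rule: blocks.induct) (simp_all add: takeWhile_map dropWhile_map comp_def)

text \<open>A final minimum stops every \<open>takeWhile\<close> and so forms a block of its own: a
  new fixed point.\<close>

lemma length_blocks_append_min:
  assumes "\<And>y. y \<in> set w \<Longrightarrow> x < y"
  shows "length (blocks (w @ [x])) = Suc (length (blocks w))"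
  using assms
proof (induction w rule: blocks.induct)
  case (2 y w)
  have "\<not> y < x" using "2.prems"[of y] by auto
  moreover have "length (blocks (dropWhile (\<lambda>z. y < z) w @ [x])) = Suc (length (blocks (dropWhile (\<lambda>z. y < z) w)))"
    using "2.IH" "2.prems" by (meson list.set_intros(2) set_dropWhileD)
  ultimately show ?case
    by (simp add: dropWhile_append3 takeWhile_tail)
qed simp

lemma length_blocks_Cons_min:
  assumes "\<And>y. y \<in> set w \<Longrightarrow> x < y"
  shows "length (blocks (x # w)) = 1"
  using assms by (simp add: dropWhile_eq_Nil_conv[THEN iffD2])

section \<open>Insertion of the letter 1 and the resulting recurrence\<close>

lemma word_insert_min_iff:
  "map Suc xs @ 1 # map Suc ys \<in> permutations_of_set {1..Suc n} \<longleftrightarrow>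
     xs @ ys \<in> permutations_of_set {1..n}" if "0 \<notin> set (xs @ ys)"
proof -
  have "{1..Suc n} = insert 1 (Suc ` {1..n})"
    by (auto simp: image_Suc_atLeastAtMost)
  moreover have "1 \<notin> Suc ` set (xs @ ys)" using that by auto
  moreover have "1 \<notin> Suc ` {1..n}" by auto
  ultimately have "insert 1 (Suc ` set (xs @ ys)) = {1..Suc n} \<longleftrightarrow> Suc ` set (xs @ ys) = Suc ` {1..n}"
    by (metis insert_ident)
  also have "\<dots> \<longleftrightarrow> set (xs @ ys) = {1..n}"
    by (rule inj_image_eq_iff) simp
  finally show ?thesis
    using that by (auto simp: permutations_of_set_def distinct_map image_Un)
qed

lemma words_insert_minE:
  assumes "w \<in> permutations_of_set {1..Suc n}"
  obtains xs ys where "w = map Suc xs @ 1 # map Suc ys" "xs @ ys \<in> permutations_of_set {1..n}"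
proof -
  have w: "set w = {1..Suc n}" "distinct w"
    using assms by (auto dest: permutations_of_setD)
  then obtain us vs where uv: "w = us @ 1 # vs"
    by (metis split_list atLeastAtMost_iff le_add1 le_refl plus_1_eq_Suc)
  have "y \<noteq> 0 \<and> y \<noteq> 1" if "y \<in> set (us @ vs)" for y
  proof -
    have "y \<in> {1..Suc n}" using that w(1) uv by auto
    moreover have "y \<noteq> 1" using that w(2) uv by auto
    ultimately show ?thesis by auto
  qed
  then have gt: "1 < y" if "y \<in> set (us @ vs)" for y
    using that by (metis less_one linorder_neqE_nat)
  \<comment> \<open>All these letters exceed 1, so the truncated subtraction is undone by
    \<open>Suc\<close> and never yields 0.\<close>
  define xs ys where "xs = map (\<lambda>y. y - 1) us" and "ys = map (\<lambda>y. y - 1) vs"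
  have "map Suc xs = us" "map Suc ys = vs" "0 \<notin> set (xs @ ys)"
    using gt by (force simp: xs_def ys_def intro!: map_idI)+
  then show ?thesis
    using that[of xs ys] assms uv word_insert_min_iff[of xs ys n] by metis
qed

lemma word_gt_0: "(w :: nat list) \<in> permutations_of_set {1..n} \<Longrightarrow> y \<in> set w \<Longrightarrow> 0 < y"
  by (metis One_nat_def Suc_le_eq atLeastAtMost_iff permutations_of_setD(1))

lemma card_occ_212'_insert_1:
  assumes "xs @ ys \<in> permutations_of_set {1..n}"
  shows "card (occ_212' (map Suc xs @ 1 # map Suc ys)) = card (occ_212' (xs @ ys)) + length xs * length ys"
proof -
  have "card (occ_212' (map Suc xs @ 1 # map Suc ys))
      = card (occ_212' (map Suc (xs @ ys))) + length xs * length ys"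
    using card_occ_212'_insert_min[of "map Suc xs" "map Suc ys" 1] word_gt_0[OF assms] by auto
  then show ?thesis
    by (simp only: occ_212'_map_Suc)
qed

text \<open>The bound on \<open>n\<close> is sharp: at length 3, an interior position has one letter
  on one side and two on the other, which creates exactly two occurrences.\<close>

lemma words_212'_Suc:
  assumes "4 \<le> n"
  shows "words_212' 2 (Suc n) =
    (\<lambda>w. 1 # map Suc w) ` words_212' 2 n \<union> (\<lambda>w. map Suc w @ [1]) ` words_212' 2 n" (is "_ = ?A \<union> ?B")
proof (intro equalityI subsetI)
  fix w assume "w \<in> words_212' 2 (Suc n)"
  then have w: "w \<in> permutations_of_set {1..Suc n}" "card (occ_212' w) = 2"
    by (auto simp: words_212'_def)
  obtain xs ys where xy: "w = map Suc xs @ 1 # map Suc ys" "xs @ ys \<in> permutations_of_set {1..n}"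
    using words_insert_minE[OF w(1)] .
  have occ: "card (occ_212' (xs @ ys)) + length xs * length ys = 2"
    using card_occ_212'_insert_1[OF xy(2)] w(2) xy(1) by simp
  have len: "length xs + length ys = n"
    using length_finite_permutations_of_set[OF xy(2)] by simp
  have "xs = [] \<or> ys = []"
  proof (rule ccontr)
    assume "\<not> ?thesis"
    \<comment> \<open>The product is at least \<open>a + b + 1 = n - 1\<close>, hence at least
      3.\<close>
    then obtain a b where "length xs = Suc a" "length ys = Suc b"
      by (metis length_0_conv old.nat.exhaust)
    then show False
      using occ len assms by simp
  qed
  then show "w \<in> ?A \<union> ?B"
    using xy occ by (auto simp: words_212'_def)
next
  fix w assume "w \<in> ?A \<union> ?B"
  then obtain xs ys where xy: "xs @ ys \<in> words_212' 2 n" "xs = [] \<or> ys = []"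
    "w = map Suc xs @ 1 # map Suc ys"
    by (metis (no_types, lifting) UnE append_Nil append_Nil2 imageE list.simps(8))
  then have W: "xs @ ys \<in> permutations_of_set {1..n}"
    by (simp add: words_212'_def)
  have "0 \<notin> set (xs @ ys)"
    using word_gt_0[OF W] by blast
  then show "w \<in> words_212' 2 (Suc n)"
    using xy W word_insert_min_iff[of xs ys n] card_occ_212'_insert_1[OF W]
    by (auto simp: words_212'_def)
qed

lemma finite_words_212': "finite (words_212' k n)"
  by (simp add: words_212'_def)

text \<open>A leading minimum merges everything into one cycle, so all words contribute to
  \<open>m = 1\<close> at once; a trailing one shifts \<open>m\<close> by one. The case
  \<open>m = 0\<close> is separate because \<open>m - 1\<close> would truncate to 0.\<close>

lemma f_212'_Suc:
  assumes "4 \<le> n"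
  shows "f_212' 2 m (Suc n) =
    (if m = 1 then card (words_212' 2 n) else 0) + (if m = 0 then 0 else f_212' 2 (m - 1) n)"
proof -
  let ?T = "words_212' 2 n"
  let ?f = "\<lambda>w. 1 # map Suc w" and ?g = "\<lambda>w. map Suc w @ [1::nat]"
  let ?A = "{w \<in> ?T. m = 1}" and ?B = "{w \<in> ?T. m = Suc (length (blocks w))}"
  have gt: "1 < y" if "w \<in> ?T" "y \<in> set (map Suc w)" for w y
    using that word_gt_0[of w n] by (auto simp: words_212'_def)
  have "length (blocks (?f w)) = 1" if "w \<in> ?T" for w
    using length_blocks_Cons_min gt[OF that] by blast
  moreover have "length (blocks (?g w)) = Suc (length (blocks w))" if "w \<in> ?T" for w
    using length_blocks_append_min[of "map Suc w" 1] gt[OF that] length_blocks_map_Suc by metis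
  ultimately have "{w \<in> words_212' 2 (Suc n). length (blocks w) = m} = ?f ` ?A \<union> ?g ` ?B"
    unfolding words_212'_Suc[OF assms] by (auto simp del: blocks.simps)
  \<comment> \<open>A common word would start with 1, yet its first letter comes from the nonempty
    \<open>map Suc v\<close>, whose letters exceed 1.\<close>
  moreover have "?f ` ?A \<inter> ?g ` ?B = {}"
  proof (rule ccontr)
    assume "\<not> ?thesis"
    then obtain u v where uv: "v \<in> ?T" "?f u = ?g v"
      by blast
    then have "length v = n"
      using length_finite_permutations_of_set by (fastforce simp: words_212'_def)
    then have "v \<noteq> []" using assms by auto
    then have "1 \<in> set (map Suc v)"
      using uv(2) by (cases v) auto
    then show False
      using gt[OF uv(1)] by blast
  qed
  moreover have "card (?f ` ?A) = card ?A" "card (?g ` ?B) = card ?B"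
    by (auto intro!: card_image inj_onI)
  ultimately have "f_212' 2 m (Suc n) = card ?A + card ?B"
    unfolding f_212'_words by (simp add: card_Un_disjoint finite_words_212')
  also have "card ?B = (if m = 0 then 0 else f_212' 2 (m - 1) n)"
    by (cases m) (auto simp: f_212'_words intro!: arg_cong[where f = card])
  finally show ?thesis by auto
qed

lemma card_words_212'_Suc:
  assumes "4 \<le> n"
  shows "card (words_212' 2 (Suc n)) = 2 * card (words_212' 2 n)"
proof -
  let ?T = "words_212' 2 n"
  let ?f = "\<lambda>w. 1 # map Suc w" and ?g = "\<lambda>w. map Suc w @ [1::nat]"
  have "?f ` ?T \<inter> ?g ` ?T = {}"
  proof (rule ccontr)
    assume "\<not> ?thesis"
    then obtain u v where uv: "v \<in> ?T" "?f u = ?g v"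
      by blast
    then have v: "v \<in> permutations_of_set {1..n}"
      by (simp add: words_212'_def)
    then have "v \<noteq> []"
      using length_finite_permutations_of_set[OF v] assms by auto
    then have "0 \<in> set v"
      using uv(2) by (cases v) auto
    then show False
      using word_gt_0[OF v] by blast
  qed
  moreover have "card (?f ` ?T) = card ?T" "card (?g ` ?T) = card ?T"
    by (auto intro!: card_image inj_onI)
  ultimately show ?thesis
    unfolding words_212'_Suc[OF assms] by (simp add: card_Un_disjoint finite_words_212')
qed

section \<open>Words of length at most four\<close>

text \<open>A bounded list form, so that the small cases can be evaluated.\<close>

lemma occ_212'_code:
  "occ_212' w = set [(i, j, k). j \<leftarrow> [0..<length w], i \<leftarrow> [0..<j], w ! j < w ! i,
     k \<leftarrow> [Suc j..<length w], w ! j < w ! k]"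
  by (auto simp: occ_212'_def)

lemma words_212'_code:
  "words_212' k n = set (filter (\<lambda>w. card (occ_212' w) = k) (permutations_of_set_list [1..<Suc n]))"
proof -
  have "{1..n} = set [1..<Suc n]" by auto
  then have "permutations_of_set {1..n} = set (permutations_of_set_list [1..<Suc n])"
    using permutations_of_list[of "[1..<Suc n]"] by (simp add: distinct_remdups_id)
  then show ?thesis by (auto simp: words_212'_def)
qed

text \<open>Such a word has at most one triple of positions \<open>i < j < k\<close>. The recurrence
  does not reach these lengths.\<close>

lemma words_212'_2_less_4:
  assumes "n < 4"
  shows "words_212' 2 n = {}"
proof -
  have "words_212' 2 0 = {}" "words_212' 2 1 = {}" "words_212' 2 2 = {}" "words_212' 2 3 = {}"
    unfolding words_212'_code occ_212'_code by code_simp+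
  moreover have "n = 0 \<or> n = 1 \<or> n = 2 \<or> n = 3"
    using assms by auto
  ultimately show ?thesis by metis
qed

text \<open>Each word has 1 in an interior place, inserted into one of the four words of length 3
  without an occurrence.\<close>

lemma words_212'_2_4:
  "words_212' 2 4 = set [[2,1,3,4], [2,1,4,3], [2,3,1,4], [2,4,1,3],
     [3,1,4,2], [3,4,1,2], [4,1,3,2], [4,3,1,2]]"
  unfolding words_212'_code occ_212'_code by code_simp

section \<open>Closed forms by induction from length 4\<close>

lemma card_words_212'_2:
  assumes "4 \<le> n"
  shows "card (words_212' 2 n) = 2 ^ (n - 1)"
  using assms
proof (induction n rule: dec_induct)
  case base
  show ?case unfolding words_212'_2_4 by simp
next
  case (step n)
  then show ?case by (cases n) (simp_all add: card_words_212'_Suc)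
qed

text \<open>Only \<open>[4,3,1,2]\<close> has three left-to-right minima; the other seven words have
  two.\<close>

lemma f_212'_2_4: "f_212' 2 m 4 = (if m = 2 then 7 else if m = 3 then 1 else 0)"
proof -
  let ?L = "[[2,1,3,4], [2,1,4,3], [2,3,1,4], [2,4,1,3],
     [3,1,4,2], [3,4,1,2], [4,1,3,2], [4,3,1,2]] :: nat list list"
  have "{w \<in> words_212' 2 4. length (blocks w) = m} = set (filter (\<lambda>w. length (blocks w) = m) ?L)"
    unfolding words_212'_2_4 by (simp only: set_filter)
  moreover have "distinct ?L" by simp
  ultimately have "f_212' 2 m 4 = length (filter (\<lambda>w. length (blocks w) = m) ?L)"
    unfolding f_212'_words by (simp only: distinct_card distinct_filter)
  then show ?thesis by simp
qed

text \<open>For positive \<open>m\<close> each case depends only on \<open>n - m\<close>, which the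
  recurrence preserves when \<open>m > 1\<close>. For \<open>m = 1\<close> the value is the total
  number of words of the previous length. Additive conditions avoid truncated subtraction.\<close>

lemma f_212'_2:
  assumes "4 \<le> n"
  shows "f_212' 2 m n = (if m = 0 then 0 else if m + 4 \<le> n then 2 ^ (n - m - 1)
    else if m + 2 = n then 7 else if m + 1 = n then 1 else 0)"
  using assms
proof (induction n arbitrary: m rule: dec_induct)
  case base
  show ?case by (auto simp: f_212'_2_4)
next
  case (step n)
  have "f_212' 2 m (Suc n) =
    (if m = 1 then 2 ^ (n - 1) else 0) + (if m = 0 then 0 else f_212' 2 (m - 1) n)"
    using f_212'_Suc step.hyps(1) card_words_212'_2 by simp
  then show ?case
    using step by (cases "m = 0"; cases "m = 1") auto
qed

theorem mainTheorem18:
  shows "(\<forall>m n. 1 \<le> m \<and> m + 4 \<le> n \<longrightarrow> f_212' 2 m n = 2 ^ (n - m - 1)) \<and>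
         (\<forall>n\<ge>4. f_212' 2 (n - 2) n = 7) \<and>
         (\<forall>n\<ge>4. f_212' 2 (n - 1) n = 1) \<and>
         (\<forall>m n. \<not> (1 \<le> m \<and> m + 4 \<le> n) \<and> \<not> (4 \<le> n \<and> m = n - 2) \<and> \<not> (4 \<le> n \<and> m = n - 1)
            \<longrightarrow> f_212' 2 m n = 0)"
proof (intro conjI allI impI)
  fix m n :: nat assume *: "\<not> (1 \<le> m \<and> m + 4 \<le> n) \<and> \<not> (4 \<le> n \<and> m = n - 2) \<and> \<not> (4 \<le> n \<and> m = n - 1)"
  show "f_212' 2 m n = 0"
  proof (cases "4 \<le> n")
    case True
    then show ?thesis using * by (auto simp: f_212'_2)
  next
    \<comment> \<open>For \<open>n < 4\<close> the recurrence says nothing; there are no words to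
      count.\<close>
    case False
    then show ?thesis by (simp add: f_212'_words words_212'_2_less_4)
  qed
qed (auto simp: f_212'_2)

end
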